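(* Let $n \geq 2$, $a$ and $k$ be integers. If $$k(a,a-1,n-1,n-a-1,n-a)_n = (n-a,n-a-1,n-1,a-1,a)_n$$ is a $5$-digit solution for $n$, then $$k(a,a-1,n-a-1,n-a)_n = (n-a,n-a-1,a-1,a)_n$$ is a $4$-digit solution for $n$ (with the same $k$).
   Context: For integers $n \geq 2$, $h \geq 1$ and $a_0,\dots,a_h$, write $(a_h,a_{h-1},\dots,a_1,a_0)_n = a_h n^h + a_{h-1}n^{h-1} + \cdots + a_1 n + a_0$. Given an integer $k$, one says that $k(a_h,a_{h-1},\dots,a_1,a_0)_n = (a_0,a_1,\dots,a_{h-1},a_h)_n$ is an $(h+1)$-digit solution for $n$ if this equality of integers holds and, moreover, $1<k<n$, $0 \leq a_i \leq n-1$ for all $i$, $a_0 \neq 0$, and $a_h \neq 0$. *)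

theory Defs
  imports Main
begin

text \<open>
  Digit lists are written most significant digit first: \<open>base_value n [a\<^sub>h, \<dots>, a\<^sub>1, a\<^sub>0]\<close>
  is \<open>(a\<^sub>h, \<dots>, a\<^sub>1, a\<^sub>0)\<^sub>n\<close>.  Entries are arbitrary integers here; the digit
  bounds are part of \<open>digit_solution\<close>.
\<close>

definition base_value :: "int \<Rightarrow> int list \<Rightarrow> int" where
  "base_value n ds = (\<Sum>i<length ds. rev ds ! i * n ^ i)"

text \<open>
  \<open>digit_solution m n k xs ys\<close>: the equality \<open>k (xs)\<^sub>n = (ys)\<^sub>n\<close> is an \<open>m\<close>-digit solution
  for \<open>n\<close>.  With \<open>m = h + 1\<close>, the condition \<open>2 \<le> m\<close> is \<open>h \<ge> 1\<close>, and \<open>hd xs\<close>, \<open>last xs\<close>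
  are \<open>a\<^sub>h\<close>, \<open>a\<^sub>0\<close>.
\<close>

definition digit_solution :: "nat \<Rightarrow> int \<Rightarrow> int \<Rightarrow> int list \<Rightarrow> int list \<Rightarrow> bool" where
  "digit_solution m n k xs ys \<longleftrightarrow>
     2 \<le> n \<and> 2 \<le> m \<and> length xs = m \<and> ys = rev xs \<and>
     k * base_value n xs = base_value n ys \<and>
     1 < k \<and> k < n \<and>
     (\<forall>d \<in> set xs. 0 \<le> d \<and> d \<le> n - 1) \<and>
     last xs \<noteq> 0 \<and> hd xs \<noteq> 0"

end

theory Submission imports Defs
begin

text \<open>
  The borrows hidden in the digits telescope: the five-digit number on the left is
  \<open>a (n + 1) (n\<^sup>3 - 1)\<close>, and the four-digit one is \<open>a (n + 1) (n\<^sup>2 - 1)\<close>.  Reversing the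
  digits amounts to replacing \<open>a\<close> by \<open>n - a\<close>, so in both lengths the equation between the
  two numbers is \<open>k a = n - a\<close> multiplied by a factor which does not vanish for \<open>n \<ge> 2\<close>.
  Cancelling the factor of length five and multiplying by that of length four proves the
  claim; the digits of the shorter number all occur in the longer one, so they stay in range.
\<close>

lemma base_value_five_digits:
  "base_value n [a, a - 1, n - 1, n - a - 1, n - a] = a * ((n + 1) * (n ^ 3 - 1))"
  by (simp add: base_value_def lessThan_Suc eval_nat_numeral algebra_simps)

lemma base_value_four_digits:
  "base_value n [a, a - 1, n - a - 1, n - a] = a * ((n + 1) * (n ^ 2 - 1))"
  by (simp add: base_value_def lessThan_Suc eval_nat_numeral algebra_simps)

theorem theorem2:
  fixes n a k :: int
  assumes "2 \<le> n"
    and "digit_solution 5 n k [a, a - 1, n - 1, n - a - 1, n - a] [n - a, n - a - 1, n - 1, a - 1, a]"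
  shows "digit_solution 4 n k [a, a - 1, n - a - 1, n - a] [n - a, n - a - 1, a - 1, a]"
proof -
  have "k * base_value n [a, a - 1, n - 1, n - a - 1, n - a]
      = base_value n [n - a, n - a - 1, n - 1, a - 1, a]"
    using assms(2) by (simp add: digit_solution_def)
  then have "(k * a) * ((n + 1) * (n ^ 3 - 1)) = (n - a) * ((n + 1) * (n ^ 3 - 1))"
    using base_value_five_digits[of n a] base_value_five_digits[of n "n - a"]
    by (simp add: mult.assoc)
  moreover have "(n + 1) * (n ^ 3 - 1) \<noteq> 0"
  proof -
    have "1 < n ^ 3"
      using assms(1) by (intro one_less_power) simp_all
    then have "0 < (n + 1) * (n ^ 3 - 1)"
      using assms(1) by (intro mult_pos_pos) linarith+
    then show ?thesis by linarith
  qed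
  ultimately have "k * a = n - a"
    by (metis mult_right_cancel)
  then have "k * base_value n [a, a - 1, n - a - 1, n - a]
      = base_value n [n - a, n - a - 1, a - 1, a]"
    using base_value_four_digits[of n a] base_value_four_digits[of n "n - a"]
    by (simp flip: mult.assoc)
  then show ?thesis
    using assms(2) by (simp add: digit_solution_def)
qed

end
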